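(* Let $\mathfrak g=\mathfrak{sl}_n$, whose Coxeter number is $h=n$. Then for every $k\in\{1,\dots,n\}$, $$(\Delta^+_k)^*=\Delta^+_{h+1-k}=\Delta^+_{n+1-k}.$$
   Context: Positive roots of $\mathfrak{sl}_n$ ($n\ge2$) are identified with pairs $(i,j)$, $1\le i<j\le n$, where $\alpha_i=(i,i+1)$ are the simple roots and $(i,j)=\alpha_i+\dots+\alpha_{j-1}$ has height $\mathrm{ht}(i,j)=j-i$. $\Delta_k^+=\{\gamma\in\Delta^+\mid\mathrm{ht}(\gamma)\ge k\}$ (so $\Delta_n^+=\varnothing$). An $\mathsf{ad}$-nilpotent ideal is a set $I$ of positive roots such that $(i,j)\in I$, $i'\le i$, $j'\ge j$ imply $(i',j')\in I$; its generators are its minimal elements in the root order. Each $\Delta_k^+$ is an $\mathsf{ad}$-nilpotent ideal. Duality $I\mapsto I^*$: if the generators of $I$ are $(i_1,j_1),\dots,(i_k,j_k)$, then $I^*$ is the ideal with generators $(i_q^*,j_q^* )$, $1\le q\le n-1-k$, where $i_1^*<i_2^*<\cdots$ are the elements of $\{1,\dots,n-1\}\setminus\{j_1-1,\dots,j_k-1\}$ and $j_1^*<j_2^*<\cdots$ are the elements of $\{2,\dots,n\}\setminus\{i_1+1,\dots,i_k+1\}$. This is a well-defined involution on the set of $\mathsf{ad}$-nilpotent ideals of $\mathfrak{sl}_n$. *)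

theory Defs
  imports Complex_Main "HOL-Combinatorics.Transposition"
begin

text \<open>
  Positive roots of \<open>sl_n\<close> are the pairs \<open>(i, j)\<close> with \<open>1 \<le> i < j \<le> n\<close>; the pair \<open>(i, j)\<close>
  stands for \<open>\<alpha>\<^sub>i + \<dots> + \<alpha>\<^sub>j\<^sub>-\<^sub>1\<close>, where \<open>\<alpha>\<^sub>m = (m, m + 1)\<close> are the simple roots.
\<close>

type_synonym root = "nat \<times> nat"

definition pos_roots :: "nat \<Rightarrow> root set" where
  "pos_roots n = {(i, j). 1 \<le> i \<and> i < j \<and> j \<le> n}"

definition root_ht :: "root \<Rightarrow> nat" where
  "root_ht \<gamma> = snd \<gamma> - fst \<gamma>"

definition Delta_ge :: "nat \<Rightarrow> nat \<Rightarrow> root set" where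
  "Delta_ge n k = {\<gamma> \<in> pos_roots n. k \<le> root_ht \<gamma>}"

text \<open>Coefficient of \<open>\<alpha>\<^sub>m\<close> in the expansion of a positive root in simple roots.\<close>

definition simple_coeff :: "root \<Rightarrow> nat \<Rightarrow> nat" where
  "simple_coeff \<gamma> m = (if fst \<gamma> \<le> m \<and> m < snd \<gamma> then 1 else 0)"

text \<open>Root order: \<open>\<delta> - \<gamma>\<close> is a nonnegative integer combination of simple roots.\<close>

definition root_le :: "root \<Rightarrow> root \<Rightarrow> bool" where
  "root_le \<gamma> \<delta> \<longleftrightarrow> (\<forall>m. simple_coeff \<gamma> m \<le> simple_coeff \<delta> m)"

lemma root_le_iff:
  assumes "i < j"
  shows "root_le (i, j) (i', j') \<longleftrightarrow> i' \<le> i \<and> j \<le> j'"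
proof
  assume "root_le (i, j) (i', j')"
  then have "simple_coeff (i, j) i \<le> simple_coeff (i', j') i"
    and "simple_coeff (i, j) (j - 1) \<le> simple_coeff (i', j') (j - 1)"
    by (simp_all add: root_le_def)
  with assms show "i' \<le> i \<and> j \<le> j'"
    by (auto simp: simple_coeff_def split: if_splits)
next
  assume "i' \<le> i \<and> j \<le> j'"
  then show "root_le (i, j) (i', j')"
    by (auto simp: root_le_def simple_coeff_def)
qed

definition ad_nilpotent_ideal :: "nat \<Rightarrow> root set \<Rightarrow> bool" where
  "ad_nilpotent_ideal n I \<longleftrightarrow> I \<subseteq> pos_roots n \<and>
     (\<forall>(i, j) \<in> I. \<forall>(i', j') \<in> pos_roots n. i' \<le> i \<and> j \<le> j' \<longrightarrow> (i', j') \<in> I)"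

definition ideal_gens :: "root set \<Rightarrow> root set" where
  "ideal_gens I = {\<gamma> \<in> I. \<forall>\<delta> \<in> I. root_le \<delta> \<gamma> \<longrightarrow> \<delta> = \<gamma>}"

text \<open>
  The pairs \<open>(i\<^sub>q\<^sup>*, j\<^sub>q\<^sup>*)\<close>: the two complements listed in increasing order and paired off.
  The \<open>k\<close> generators of an ideal are an antichain, so their first entries are pairwise
  distinct, and so are their second entries; hence both lists have length \<open>n - 1 - k\<close> and
  \<open>zip\<close> drops nothing.
\<close>

definition dual_gens :: "nat \<Rightarrow> root set \<Rightarrow> root set" where
  "dual_gens n I = set (zip
     (sorted_list_of_set ({1..n - 1} - (\<lambda>(i, j). j - 1) ` ideal_gens I))
     (sorted_list_of_set ({2..n} - (\<lambda>(i, j). i + 1) ` ideal_gens I)))"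

definition ideal_dual :: "nat \<Rightarrow> root set \<Rightarrow> root set" where
  "ideal_dual n I = (THE J. ad_nilpotent_ideal n J \<and> ideal_gens J = dual_gens n I)"

text \<open>
  The Weyl group of \<open>sl_n\<close> is the symmetric group on \<open>{1..n}\<close>, with simple reflections the
  transpositions of \<open>i\<close> and \<open>i + 1\<close>. The Coxeter number is the order of the Coxeter element
  \<open>s\<^sub>1 \<circ> \<dots> \<circ> s\<^sub>n\<^sub>-\<^sub>1\<close>.
\<close>

definition coxeter_element :: "nat \<Rightarrow> nat \<Rightarrow> nat" where
  "coxeter_element n = foldr (\<lambda>i w. transpose i (i + 1) \<circ> w) [1..<n] id"

definition coxeter_number :: "nat \<Rightarrow> nat" where
  "coxeter_number n = (LEAST m. 0 < m \<and> (coxeter_element n ^^ m) = id)"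

end

theory Submission
  imports Defs
begin

text \<open>
  The generators of \<open>\<Delta>\<^sub>k\<^sup>+\<close> are the roots of height exactly \<open>k\<close>, that is \<open>(i, i + k)\<close> with
  \<open>1 \<le> i \<le> n - k\<close>. The complements that define the dual are therefore the intervals
  \<open>{1..k-1}\<close> and \<open>{n-k+2..n}\<close>, and pairing them in increasing order gives precisely the roots of
  height \<open>n + 1 - k\<close>. An ideal is determined by its generators, so the dual is \<open>\<Delta>\<^sub>n\<^sub>+\<^sub>1\<^sub>-\<^sub>k\<^sup>+\<close>.
  The Coxeter element is the cycle \<open>1 \<mapsto> 2 \<mapsto> \<dots> \<mapsto> n \<mapsto> 1\<close>, of order \<open>n\<close>.
\<close>

text \<open>\<open>foldr\<close> over \<open>[1..<Suc n]\<close> takes the new reflection as its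
  starting value in place of \<open>id\<close>; associativity of composition moves it out to the
  right end.\<close>

lemma coxeter_element_Suc:
  assumes "1 \<le> n"
  shows "coxeter_element (Suc n) = coxeter_element n \<circ> transpose n (Suc n)"
proof -
  have "foldr (\<lambda>i w. transpose i (i + 1) \<circ> w) xs v
      = foldr (\<lambda>i w. transpose i (i + 1) \<circ> w) xs id \<circ> v" for xs and v :: "nat \<Rightarrow> nat"
    by (induction xs) (simp_all add: comp_assoc)
  from this[of "[1..<n]" "transpose n (n + 1)"] show ?thesis
    using assms by (simp add: coxeter_element_def)
qed

lemma coxeter_element_apply:
  assumes "1 \<le> n"
  shows "coxeter_element n x = (if 1 \<le> x \<and> x < n then x + 1 else if x = n then 1 else x)"
  using assms
proof (induction n arbitrary: x rule: dec_induct)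
  case base
  show ?case by (simp add: coxeter_element_def)
next
  case (step n)
  then show ?case
    by (auto simp: coxeter_element_Suc transpose_def)
qed

lemma coxeter_element_funpow:
  assumes "1 \<le> x" and "x + m \<le> n"
  shows "(coxeter_element n ^^ m) x = x + m"
  using assms by (induction m) (simp_all add: coxeter_element_apply)

lemma coxeter_element_funpow_self:
  assumes "1 \<le> n"
  shows "coxeter_element n ^^ n = id"
proof
  fix x
  show "(coxeter_element n ^^ n) x = id x"
  proof (cases "1 \<le> x \<and> x \<le> n")
    case True
    \<comment> \<open>Once round the cycle: \<open>n - x\<close> steps from \<open>x\<close> up to
      \<open>n\<close>, one step from \<open>n\<close> to 1, then \<open>x - 1\<close> steps back up
      to \<open>x\<close>.\<close>
    then have "n = (x - 1) + (Suc (n - x))"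
      by simp
    then have "(coxeter_element n ^^ n) x
        = (coxeter_element n ^^ (x - 1)) (coxeter_element n ((coxeter_element n ^^ (n - x)) x))"
      by (metis comp_apply funpow.simps(2) funpow_add)
    also have "\<dots> = x"
      using True assms by (simp add: coxeter_element_funpow coxeter_element_apply)
    finally show ?thesis by simp
  next
    case False
    then have "coxeter_element n x = x"
      using assms by (auto simp: coxeter_element_apply)
    then have "(coxeter_element n ^^ m) x = x" for m
      by (induction m) simp_all
    then show ?thesis by simp
  qed
qed

lemma coxeter_number_eq:
  assumes "1 \<le> n"
  shows "coxeter_number n = n"
  unfolding coxeter_number_def
proof (rule Least_equality)
  show "0 < n \<and> coxeter_element n ^^ n = id"
    using assms coxeter_element_funpow_self by simp
next
  fix m
  assume m: "0 < m \<and> coxeter_element n ^^ m = id"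
  show "n \<le> m"
  proof (rule ccontr)
    assume "\<not> n \<le> m"
    \<comment> \<open>Fewer than \<open>n\<close> steps from 1 do not wrap around, so a positive
      power below the \<open>n\<close>-th moves 1.\<close>
    then have "(coxeter_element n ^^ m) 1 = 1 + m"
      by (intro coxeter_element_funpow) simp_all
    with m show False by simp
  qed
qed

text \<open>Descent on height: a non-minimal element has a different root of \<open>I\<close> below
  it, and that root has smaller height.\<close>

lemma exists_gen_le:
  assumes "I \<subseteq> pos_roots n" and "\<gamma> \<in> I"
  shows "\<exists>\<delta>\<in>ideal_gens I. root_le \<delta> \<gamma>"
  using \<open>\<gamma> \<in> I\<close>
proof (induction "root_ht \<gamma>" arbitrary: \<gamma> rule: less_induct)
  case less
  show ?case
  proof (cases "\<gamma> \<in> ideal_gens I")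
    case True
    then show ?thesis by (auto simp: root_le_def)
  next
    case False
    then obtain \<delta> where \<delta>: "\<delta> \<in> I" "root_le \<delta> \<gamma>" "\<delta> \<noteq> \<gamma>"
      using less.prems by (auto simp: ideal_gens_def)
    have "fst \<delta> < snd \<delta>" and "fst \<gamma> < snd \<gamma>"
      using \<delta>(1) less.prems assms(1) by (auto simp: pos_roots_def)
    then have "root_ht \<delta> < root_ht \<gamma>"
      using \<delta>(2,3) by (cases \<delta>; cases \<gamma>) (auto simp: root_le_iff root_ht_def)
    from less.hyps[OF this \<delta>(1)] \<delta>(2) show ?thesis
      by (meson le_trans root_le_def)
  qed
qed

lemma ad_nilpotent_ideal_root_le:
  assumes "ad_nilpotent_ideal n I" and "\<gamma> \<in> I" and "\<delta> \<in> pos_roots n" and "root_le \<gamma> \<delta>"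
  shows "\<delta> \<in> I"
  using assms by (cases \<gamma>; cases \<delta>) (fastforce simp: ad_nilpotent_ideal_def pos_roots_def root_le_iff)

text \<open>Each element of \<open>I\<close> lies above a generator, which belongs to
  \<open>J\<close>, and \<open>J\<close> is closed upwards. Used in both directions, this gives the
  uniqueness that \<open>THE\<close> in \<open>ideal_dual\<close> needs.\<close>

lemma ad_nilpotent_ideal_subset_of_gens:
  assumes "ad_nilpotent_ideal n I" and "ad_nilpotent_ideal n J" and "ideal_gens I \<subseteq> ideal_gens J"
  shows "I \<subseteq> J"
proof
  fix \<gamma>
  assume \<gamma>: "\<gamma> \<in> I"
  have sub: "I \<subseteq> pos_roots n"
    using assms(1) by (simp add: ad_nilpotent_ideal_def)
  obtain \<delta> where "\<delta> \<in> ideal_gens I" "root_le \<delta> \<gamma>"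
    using exists_gen_le[OF sub \<gamma>] by blast
  moreover from this have "\<delta> \<in> J"
    using assms(3) by (auto simp: ideal_gens_def)
  ultimately show "\<gamma> \<in> J"
    using assms(2) \<gamma> sub ad_nilpotent_ideal_root_le by blast
qed

lemma ideal_dual_eqI:
  assumes "ad_nilpotent_ideal n J" and "ideal_gens J = dual_gens n I"
  shows "ideal_dual n I = J"
  unfolding ideal_dual_def
  using assms by (intro the_equality) (auto dest: ad_nilpotent_ideal_subset_of_gens)

lemma Delta_ge_ideal: "ad_nilpotent_ideal n (Delta_ge n k)"
  by (auto simp: ad_nilpotent_ideal_def Delta_ge_def pos_roots_def root_ht_def)

lemma ideal_gens_Delta_ge:
  assumes "1 \<le> k"
  shows "ideal_gens (Delta_ge n k) = (\<lambda>i. (i, i + k)) ` {1..n - k}"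
proof (intro equalityI subsetI)
  fix \<gamma>
  assume g: "\<gamma> \<in> ideal_gens (Delta_ge n k)"
  obtain i j where \<gamma>: "\<gamma> = (i, j)" by (cases \<gamma>)
  have ij: "1 \<le> i" "i + k \<le> j" "j \<le> n"
    using g assms by (auto simp: \<gamma> ideal_gens_def Delta_ge_def pos_roots_def root_ht_def)
  \<comment> \<open>The root of height \<open>k\<close> with the same left end lies below \<gamma>,
    so minimality forces equality.\<close>
  then have "(i, i + k) \<in> Delta_ge n k" "root_le (i, i + k) \<gamma>"
    using assms by (auto simp: \<gamma> Delta_ge_def pos_roots_def root_ht_def root_le_iff)
  then have "\<gamma> = (i, i + k)"
    using g unfolding ideal_gens_def by fastforce
  then show "\<gamma> \<in> (\<lambda>i. (i, i + k)) ` {1..n - k}"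
    using ij by auto
next
  fix \<gamma>
  assume "\<gamma> \<in> (\<lambda>i. (i, i + k)) ` {1..n - k}"
  then show "\<gamma> \<in> ideal_gens (Delta_ge n k)"
    using assms
    by (auto simp: ideal_gens_def Delta_ge_def pos_roots_def root_ht_def root_le_iff)
qed

lemma dual_gens_Delta_ge:
  assumes "1 \<le> k" and "k \<le> n"
  shows "dual_gens n (Delta_ge n k) = (\<lambda>i. (i, i + (n + 1 - k))) ` {1..k - 1}"
proof -
  have "(\<lambda>(i, j). j - 1) ` ideal_gens (Delta_ge n k) = (\<lambda>i. i + (k - 1)) ` {1..n - k}"
    using assms(1) by (simp add: ideal_gens_Delta_ge image_image)
  also have "\<dots> = {k..n - 1}"
    unfolding image_add_atLeastAtMost' using assms by simp
  finally have "{1..n - 1} - (\<lambda>(i, j). j - 1) ` ideal_gens (Delta_ge n k) = {1..<k}"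
    using assms by auto
  moreover have "(\<lambda>(i, j). i + 1) ` ideal_gens (Delta_ge n k) = {2..n - k + 1}"
    using assms(1) by (simp add: ideal_gens_Delta_ge image_image)
  \<comment> \<open>These half-open bounds exhibit the set as \<open>{1..<k}\<close> shifted by
    \<open>n + 1 - k\<close>, so \<open>zip\<close> pairs each \<open>i\<close> with
    \<open>i + (n + 1 - k)\<close>.\<close>
  then have "{2..n} - (\<lambda>(i, j). i + 1) ` ideal_gens (Delta_ge n k)
      = {1 + (n + 1 - k)..<k + (n + 1 - k)}"
    using assms by auto
  ultimately have "dual_gens n (Delta_ge n k)
      = set (zip [1..<k] [1 + (n + 1 - k)..<k + (n + 1 - k)])"
    unfolding dual_gens_def by (simp only: sorted_list_of_set_range)
  also have "[1 + (n + 1 - k)..<k + (n + 1 - k)] = map (\<lambda>i. i + (n + 1 - k)) [1..<k]"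
    by (rule nth_equalityI) simp_all
  also have "set (zip [1..<k] \<dots>) = (\<lambda>i. (i, i + (n + 1 - k))) ` {1..k - 1}"
    using assms(1) by (auto simp: zip_map2 zip_same_conv_map)
  finally show ?thesis .
qed

lemma ideal_dual_Delta_ge:
  assumes "1 \<le> k" and "k \<le> n"
  shows "ideal_dual n (Delta_ge n k) = Delta_ge n (n + 1 - k)"
proof (rule ideal_dual_eqI[OF Delta_ge_ideal])
  \<comment> \<open>The largest left end of a root of height \<open>n + 1 - k\<close> has to match
    the index range in \<open>dual_gens_Delta_ge\<close>.\<close>
  have "n - (n + 1 - k) = k - 1"
    using assms by simp
  then show "ideal_gens (Delta_ge n (n + 1 - k)) = dual_gens n (Delta_ge n k)"
    using assms by (simp only: dual_gens_Delta_ge) (subst ideal_gens_Delta_ge, simp_all)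
qed

theorem lemma4p5:
  fixes n k :: nat
  assumes "n \<ge> 2" and "k \<in> {1..n}"
  shows "coxeter_number n = n \<and>
         ideal_dual n (Delta_ge n k) = Delta_ge n (coxeter_number n + 1 - k) \<and>
         Delta_ge n (coxeter_number n + 1 - k) = Delta_ge n (n + 1 - k)"
  using assms by (simp add: coxeter_number_eq ideal_dual_Delta_ge)

end
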